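(* Let $n\ge 3$, $b>2$, and let $\widetilde b\ge 1$ be such that $\widetilde T_n$ is nonsingular. Then $$\|\widetilde T_n^{-1}\|_\infty\le\begin{cases}\dfrac{1}{b-2}\left(1-\dfrac{2(1+\widetilde b-b)(b-1)}{\widetilde b}\,\dfrac{\gamma_{\frac{n+1}{2}}}{\gamma_{n+1}}\right), & \text{if }\widetilde b>b-1,\\[2mm] \dfrac{1}{b-2}, & \text{if }\widetilde b=b-1,\\[2mm] \dfrac{b+1}{\widetilde b\,b-2}, & \text{if }1\le\widetilde b<b-1.\end{cases}$$
   Context: For an integer $n\ge 3$ and real $b,\widetilde b$, $\widetilde T_n$ is the $n\times n$ real symmetric tridiagonal matrix with diagonal entries $(\widetilde b,b,b,\dots,b,\widetilde b)$ (first and last equal to $\widetilde b$, all others equal to $b$) and all sub- and superdiagonal entries equal to $-1$. For $b>2$ put $r_1=\tfrac12(b+\sqrt{b^2-4})$, $r_2=\tfrac12(b-\sqrt{b^2-4})$ (both positive) and $\gamma_k=r_1^k-r_2^k$ for real $k\ge 0$ (in particular half-integer $k$ is allowed). $\|A\|_\infty=\max_i\sum_j|a_{i,j}|$. *)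

theory Defs
  imports Complex_Main "Jordan_Normal_Form.Gauss_Jordan_Elimination"
begin

text \<open>Rows and columns are numbered from 0, so the two corner entries of the diagonal
  are those with index 0 and \<open>n - 1\<close>.\<close>

definition T_tilde :: "nat \<Rightarrow> real \<Rightarrow> real \<Rightarrow> real mat" where
  "T_tilde n b b' = mat n n (\<lambda>(i, j).
     if i = j then (if i = 0 \<or> i = n - 1 then b' else b)
     else if i = Suc j \<or> j = Suc i then - 1
     else 0)"

definition r1 :: "real \<Rightarrow> real" where
  "r1 b = (b + sqrt (b\<^sup>2 - 4)) / 2"

definition r2 :: "real \<Rightarrow> real" where
  "r2 b = (b - sqrt (b\<^sup>2 - 4)) / 2"

text \<open>Half-integer indices occur, hence \<open>powr\<close>; for \<open>b > 2\<close> both bases are positive.\<close>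

definition \<gamma> :: "real \<Rightarrow> real \<Rightarrow> real" where
  "\<gamma> b k = r1 b powr k - r2 b powr k"

text \<open>Only meaningful for a matrix with at least one row.\<close>

definition mat_norm_inf :: "real mat \<Rightarrow> real" where
  "mat_norm_inf A = (MAX i \<in> {..<dim_row A}. \<Sum>j<dim_col A. \<bar>A $$ (i, j)\<bar>)"

text \<open>\<open>mat_inverse\<close> returns an option value, which is \<open>Some\<close> of the two-sided inverse when
  the matrix is invertible; for a singular matrix \<open>mat_inv\<close> is unspecified.\<close>

definition mat_inv :: "real mat \<Rightarrow> real mat" where
  "mat_inv A = the (mat_inverse A)"

end

theory Submission
  imports Defs
begin

text \<open>The matrix satisfies a discrete minimum principle, so its inverse is entrywise
  nonnegative and its row sums are the components of the solution \<open>u\<close> of \<open>T u = (1, \<dots>, 1)\<close>.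
  With \<open>b = 2 cosh L\<close> this solution is \<open>u\<^sub>i = (1 - c cosh ((m - i) L)) / (b - 2)\<close>, where
  \<open>m = (n - 1) / 2\<close> is the centre of symmetry and \<open>c\<close> has the sign of \<open>1 + b' - b\<close>.
  If that sign is positive, the largest component is at most the value in the centre; if it
  is negative, the largest components are those at the two ends. The recurrence
  \<open>cosh ((x + 1) L) + cosh ((x - 1) L) = b cosh (x L)\<close> then gives the stated bounds.\<close>

section \<open>The roots \<open>r1\<close>, \<open>r2\<close> and hyperbolic functions\<close>

lemma r1_gt_1:
  assumes "b > 2" shows "r1 b > 1"
proof -
  have "b\<^sup>2 > 4"
    using power_strict_mono[of 2 b 2] assms by simp
  then have "b + sqrt (b\<^sup>2 - 4) > 2 + 0"
    using assms by (intro add_strict_mono) simp_all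
  then show ?thesis by (simp add: r1_def)
qed

lemma r1_r2:
  assumes "b > 2" shows "r1 b * r2 b = 1" "r1 b + r2 b = b"
proof -
  have "sqrt (b\<^sup>2 - 4) * sqrt (b\<^sup>2 - 4) = b\<^sup>2 - 4"
    using power_mono[of 2 b 2] assms by simp
  then show "r1 b * r2 b = 1"
    by (simp add: r1_def r2_def field_simps power2_eq_square)
  show "r1 b + r2 b = b"
    by (simp add: r1_def r2_def field_simps)
qed

lemma r2_eq_inverse_r1:
  assumes "b > 2" shows "r2 b = inverse (r1 b)"
  using r1_r2(1)[OF assms] by (metis inverse_unique)

text \<open>With \<open>L = ln (r1 b)\<close> the two roots are \<open>exp L\<close> and
  \<open>exp (- L)\<close>, and their sum is \<open>b\<close>.\<close>

lemma eq_2_cosh_ln_r1: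
  assumes "b > 2" shows "b = 2 * cosh (ln (r1 b))"
  using r1_gt_1[OF assms] r1_r2(2)[OF assms] r2_eq_inverse_r1[OF assms]
  by (simp add: cosh_ln_real)

lemma gamma_eq_sinh:
  assumes "b > 2" shows "\<gamma> b k = 2 * sinh (k * ln (r1 b))"
  using r1_gt_1[OF assms]
  by (simp add: \<gamma>_def r2_eq_inverse_r1[OF assms] sinh_def powr_def ln_inverse exp_minus)

text \<open>By the double-angle formula for \<open>sinh\<close>. This turns the quotient in the
  bound into the reciprocal of a \<open>cosh\<close> value, comparable with the explicit
  solution.\<close>

lemma gamma_half_ratio:
  assumes "b > 2" "k > 0"
  shows "\<gamma> b (k / 2) / \<gamma> b k = 1 / (2 * cosh (k / 2 * ln (r1 b)))"
proof -
  define y where "y = k / 2 * ln (r1 b)"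
  have "ln (r1 b) > 0" using r1_gt_1[OF assms(1)] by simp
  then have "sinh y > 0" using assms(2) by (simp add: y_def)
  moreover have "k * ln (r1 b) = 2 * y" by (simp add: y_def)
  ultimately show ?thesis
    unfolding gamma_eq_sinh[OF assms(1)] y_def[symmetric]
    by (simp add: sinh_double)
qed

lemma cosh_recurrence:
  fixes x L :: real
  shows "cosh ((x + 1) * L) + cosh ((x - 1) * L) = 2 * cosh L * cosh (x * L)"
  by (simp add: ring_distribs cosh_add cosh_diff)

lemma cosh_mono_abs:
  fixes x y :: real
  assumes "\<bar>x\<bar> \<le> \<bar>y\<bar>" shows "cosh x \<le> cosh y"
  using assms cosh_real_nonneg_le_iff[of "\<bar>x\<bar>" "\<bar>y\<bar>"] by simp

section \<open>Rows of the matrix and the minimum principle\<close>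

lemma T_tilde_carrier [simp]: "T_tilde n b b' \<in> carrier_mat n n"
  by (simp add: T_tilde_def)

lemma T_tilde_row_sum:
  assumes "i < n"
  shows "(\<Sum>j<n. T_tilde n b b' $$ (i, j) * f j) =
    (if i = 0 \<or> i = n - 1 then b' else b) * f i
    - (if i = 0 then 0 else f (i - 1)) - (if Suc i < n then f (Suc i) else 0)"
proof -
  \<comment> \<open>For \<open>i = 0\<close> truncated subtraction makes \<open>i - 1\<close> the
    diagonal index, so the lower neighbour carries a guard of its own.\<close>
  have "(\<Sum>j<n. T_tilde n b b' $$ (i, j) * f j) =
    (\<Sum>j<n. (if j = i then (if i = 0 \<or> i = n - 1 then b' else b) * f i else 0)
      - (if j = i - 1 then (if i = 0 then 0 else f (i - 1)) else 0)
      - (if j = Suc i then f (Suc i) else 0))"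
    using assms by (intro sum.cong) (auto simp: T_tilde_def)
  also have "\<dots> = (if i = 0 \<or> i = n - 1 then b' else b) * f i
    - (if i = 0 then 0 else f (i - 1)) - (if Suc i < n then f (Suc i) else 0)"
    using assms by (simp add: sum_subtractf sum.delta)
  finally show ?thesis .
qed

text \<open>Look at the row of an index where \<open>x\<close> is minimal: in an interior row both
  neighbours are at least as large, which leaves \<open>(b - 2) * x l \<ge> 0\<close>.\<close>

lemma T_tilde_min_principle:
  assumes "n \<ge> 3" "b > 2" "b' \<ge> 1"
    and rows: "\<And>i. i < n \<Longrightarrow> (\<Sum>j<n. T_tilde n b b' $$ (i, j) * x j) \<ge> 0"
    and "k < n"
  shows "x k \<ge> 0"
proof -
  obtain i where i: "i < n" "\<And>j. j < n \<Longrightarrow> x i \<le> x j"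
    using ex_min_if_finite[of "x ` {..<n}"] assms(5) by (fastforce simp: not_less)
  have interior: "x l \<ge> 0" if "0 < l" "l < n - 1" "\<And>j. j < n \<Longrightarrow> x l \<le> x j" for l
  proof -
    have "b * x l \<ge> x (l - 1) + x (Suc l)"
    proof -
      have "l < n" "Suc l < n" "l \<noteq> 0" "l \<noteq> n - 1" using that(1,2) by auto
      with rows[of l] show ?thesis unfolding T_tilde_row_sum[OF \<open>l < n\<close>] by simp
    qed
    moreover have "x l \<le> x (l - 1)" "x l \<le> x (Suc l)"
      using that(1,2) by (auto intro!: that(3))
    ultimately have "(b - 2) * x l \<ge> 0" by (simp add: algebra_simps)
    with assms(2) show ?thesis by (simp add: zero_le_mult_iff)
  qed
  \<comment> \<open>For \<open>b' = 1\<close> the corner rows are only weakly dominant, but a negative minimum at a corner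
    is also attained by its neighbour, which is interior because \<open>n \<ge> 3\<close>.\<close>
  have corner: "x i \<ge> 0" if "b' * x i \<ge> x l" "0 < l" "l < n - 1" for l
  proof (rule ccontr)
    assume neg: "\<not> x i \<ge> 0"
    then have "b' * x i \<le> x i" using assms(3) mult_right_mono_neg[of 1 b' "x i"] by simp
    with that(1) have "x l \<le> x i" by simp
    with i have "x l \<ge> 0" by (intro interior that) force
    with \<open>x l \<le> x i\<close> neg show False by simp
  qed
  have "x i \<ge> 0"
  proof (cases "i = 0 \<or> i = n - 1")
    case True
    then show ?thesis
    proof
      assume "i = 0"
      then show ?thesis
        using rows[of 0] assms(1) corner[of 1] by (simp add: T_tilde_row_sum)
    next
      assume "i = n - 1"
      then show ?thesis
        using rows[of "n - 1"] assms(1) corner[of "n - 2"]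
        by (simp add: T_tilde_row_sum numeral_2_eq_2)
    qed
  next
    case False
    then show ?thesis using interior[of i] i by force
  qed
  with i(2)[OF assms(5)] show ?thesis by simp
qed

section \<open>The inverse and its norm\<close>

lemma mat_inv_properties:
  fixes A :: "real mat"
  assumes "A \<in> carrier_mat n n" "invertible_mat A"
  shows "mat_inv A \<in> carrier_mat n n" "A * mat_inv A = 1\<^sub>m n" "mat_inv A * A = 1\<^sub>m n"
proof -
  obtain B where B: "A * B = 1\<^sub>m n" "B * A = 1\<^sub>m (dim_row B)"
    using assms by (auto simp: invertible_mat_def inverts_mat_def)
  \<comment> \<open>Comparing column counts in the two products shows that \<open>B\<close> is
    square of size \<open>n\<close>. Then \<open>A\<close> is a unit of the matrix ring, the setting
    in which \<open>mat_inverse\<close> is specified.\<close>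
  have "dim_col (B * A) = n" "dim_col (A * B) = n" using B(1) assms(1) by auto
  with B have "B \<in> carrier_mat n n" by (metis carrier_matI index_mult_mat(3) index_one_mat(3))
  with B assms(1) have "A \<in> Units (ring_mat TYPE(real) n ())"
    by (auto simp: Units_def ring_mat_def)
  with mat_inverse(1)[OF assms(1)] obtain C where "mat_inverse A = Some C"
    by (metis option.exhaust)
  with mat_inverse(2)[OF assms(1) this]
  show "mat_inv A \<in> carrier_mat n n" "A * mat_inv A = 1\<^sub>m n" "mat_inv A * A = 1\<^sub>m n"
    by (simp_all add: mat_inv_def)
qed

lemma mult_mat_index_sum:
  assumes "A \<in> carrier_mat n n" "B \<in> carrier_mat n n" "i < n" "j < n"
  shows "(A * B) $$ (i, j) = (\<Sum>k<n. A $$ (i, k) * B $$ (k, j))"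
  using assms by (simp add: scalar_prod_def lessThan_atLeast0)

text \<open>The matrix maps each column of its inverse \<open>A\<close> to a unit vector, so the
  minimum principle makes \<open>A\<close> nonnegative. Its absolute row sums are then
  \<open>A\<close> applied to the all-ones vector \<open>T u\<close>, that is,
  \<open>u\<close>.\<close>

lemma mat_norm_inf_inv_T_tilde_le:
  assumes "n \<ge> 3" "b > 2" "b' \<ge> 1" "invertible_mat (T_tilde n b b')"
    and u: "\<And>i. i < n \<Longrightarrow> (\<Sum>j<n. T_tilde n b b' $$ (i, j) * u j) = 1"
    and le: "\<And>i. i < n \<Longrightarrow> u i \<le> K"
  shows "mat_norm_inf (mat_inv (T_tilde n b b')) \<le> K"
proof -
  let ?T = "T_tilde n b b'"
  define A where "A = mat_inv ?T"
  have A: "A \<in> carrier_mat n n" "?T * A = 1\<^sub>m n" "A * ?T = 1\<^sub>m n"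
    unfolding A_def using mat_inv_properties[OF T_tilde_carrier assms(4)] by auto
  have nonneg: "A $$ (i, j) \<ge> 0" if "i < n" "j < n" for i j
  proof (rule T_tilde_min_principle[OF assms(1-3) _ that(1)])
    fix k assume "k < n"
    then show "(\<Sum>l<n. ?T $$ (k, l) * A $$ (l, j)) \<ge> 0"
      using that by (simp add: mult_mat_index_sum[OF T_tilde_carrier A(1), symmetric] A(2))
  qed
  have row: "(\<Sum>j<n. \<bar>A $$ (i, j)\<bar>) = u i" if "i < n" for i
  proof -
    have "(\<Sum>j<n. \<bar>A $$ (i, j)\<bar>) = (\<Sum>j<n. A $$ (i, j))"
      using nonneg that by simp
    also have "\<dots> = (\<Sum>j<n. A $$ (i, j) * (\<Sum>k<n. ?T $$ (j, k) * u k))"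
      by (simp add: u)
    also have "\<dots> = (\<Sum>k<n. (\<Sum>j<n. A $$ (i, j) * ?T $$ (j, k)) * u k)"
      unfolding sum_distrib_left sum_distrib_right mult.assoc by (rule sum.swap)
    also have "\<dots> = (\<Sum>k<n. (if k = i then u k else 0))"
      using that
      by (intro sum.cong)
        (auto simp: mult_mat_index_sum[OF A(1) T_tilde_carrier, symmetric] A(3))
    also have "\<dots> = u i" using that by simp
    finally show ?thesis .
  qed
  show ?thesis
    unfolding A_def[symmetric] mat_norm_inf_def
    using A(1) assms(1) le by (auto simp: row lessThan_empty_iff)
qed

section \<open>The explicit solution and the three cases\<close>

theorem theorem3p9:
  fixes n :: nat and b b' :: real
  assumes "n \<ge> 3" and "b > 2" and "b' \<ge> 1"
    and "invertible_mat (T_tilde n b b')"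
  shows "mat_norm_inf (mat_inv (T_tilde n b b')) \<le>
    (if b' > b - 1 then
       1 / (b - 2) *
         (1 - 2 * (1 + b' - b) * (b - 1) / b' * (\<gamma> b ((real n + 1) / 2) / \<gamma> b (real n + 1)))
     else if b' = b - 1 then 1 / (b - 2)
     else (b + 1) / (b' * b - 2))"
proof -
  define L where "L = ln (r1 b)"
  define m where "m = (real n - 1) / 2"
  define D where "D x = cosh (x * L)" for x :: real
  have L: "L > 0" using r1_gt_1[OF assms(2)] by (simp add: L_def)
  have rec: "D (x + 1) + D (x - 1) = b * D x" for x
    using cosh_recurrence[of x L] eq_2_cosh_ln_r1[OF assms(2)] by (simp add: D_def L_def)
  have mono: "D x \<le> D y" if "\<bar>x\<bar> \<le> \<bar>y\<bar>" for x y
    unfolding D_def using L that by (intro cosh_mono_abs) (simp add: abs_mult)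
  have even: "D (- x) = D x" for x by (simp add: D_def)
  have D1: "D x \<ge> 1" for x by (simp add: D_def cosh_real_ge_1)
  have m: "m \<ge> 1" using assms(1) by (simp add: m_def)
  have D_less: "D (m - 1) < D m"
    using cosh_real_strict_mono[of "(m - 1) * L" "m * L"] m L by (simp add: D_def)
  \<comment> \<open>The corner equation \<open>b' * u 0 - u 1 = 1\<close>, multiplied by
    \<open>b - 2\<close>, reads \<open>c * q = 1 + b' - b\<close>; this determines
    \<open>c\<close>.\<close>
  define q where "q = b' * D m - D (m - 1)"
  have q: "q > 0"
    using mult_right_mono[OF assms(3), of "D m"] D1[of m] D_less unfolding q_def by linarith
  define c where "c = (1 + b' - b) / q"
  define u where "u i = (1 - c * D (m - real i)) / (b - 2)" for i
  have corner: "b' * (1 - c * D m) / (b - 2) - (1 - c * D (m - 1)) / (b - 2) = 1"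
  proof -
    have "c * q = 1 + b' - b" using q by (simp add: c_def)
    then have "b' * (1 - c * D m) - (1 - c * D (m - 1)) = b - 2"
      by (simp add: q_def algebra_simps)
    then show ?thesis using assms(2) by (simp add: diff_divide_distrib[symmetric])
  qed
  have u: "(\<Sum>j<n. T_tilde n b b' $$ (i, j) * u j) = 1" if i: "i < n" for i
  proof -
    consider "i = 0" | "i = n - 1" | "0 < i" "i < n - 1" using i by linarith
    then show ?thesis
    proof cases
      case 1
      have "u 0 = (1 - c * D m) / (b - 2)" "u 1 = (1 - c * D (m - 1)) / (b - 2)"
        by (simp_all add: u_def)
      then show ?thesis using corner assms(1) 1 by (simp add: T_tilde_row_sum)
    next
      case 2
      \<comment> \<open>Reflection in the centre \<open>m\<close> reduces the last row to the first,
        as \<open>D\<close> is even.\<close>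
      have "m - real (n - 1) = - m" "m - real (n - 1 - 1) = - (m - 1)"
        using assms(1) by (simp_all add: m_def field_simps of_nat_diff)
      then have "u (n - 1) = (1 - c * D m) / (b - 2)"
          "u (n - 1 - 1) = (1 - c * D (m - 1)) / (b - 2)"
        unfolding u_def by (simp_all only: even)
      then show ?thesis using corner assms(1) 2 by (simp add: T_tilde_row_sum)
    next
      case 3
      have "m - real (i - 1) = (m - real i) + 1" "m - real (Suc i) = (m - real i) - 1"
        using 3 by (simp_all add: of_nat_diff)
      then have neighbours: "u (i - 1) = (1 - c * D (m - real i + 1)) / (b - 2)"
          "u (Suc i) = (1 - c * D (m - real i - 1)) / (b - 2)"
        unfolding u_def by (simp_all only:)
      \<comment> \<open>The \<open>D\<close> terms solve the homogeneous recurrence, so in the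
        interior rows any \<open>c\<close> would do.\<close>
      have "c * D (m - real i + 1) + c * D (m - real i - 1) = b * (c * D (m - real i))"
        using rec[of "m - real i"] by (metis distrib_left mult.left_commute)
      then have "b * (1 - c * D (m - real i)) - (1 - c * D (m - real i + 1))
          - (1 - c * D (m - real i - 1)) = b - 2"
        unfolding right_diff_distrib by linarith
      then have "b * u i - u (i - 1) - u (Suc i) = 1"
        unfolding neighbours using assms(2)
        by (simp add: u_def diff_divide_distrib[symmetric])
      then show ?thesis using 3 unfolding T_tilde_row_sum[OF i] by simp
    qed
  qed
  \<comment> \<open>Only an upper bound on the components of \<open>u\<close> remains, with
    \<open>K\<close> left open for each case.\<close>
  note norm_le = mat_norm_inf_inv_T_tilde_le[OF assms u]
  consider "b' > b - 1" | "b' = b - 1" | "b' < b - 1" by linarith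
  then show ?thesis
  proof cases
    case 1
    have ratio: "\<gamma> b ((real n + 1) / 2) / \<gamma> b (real n + 1) = 1 / (2 * D (m + 1))"
    proof -
      have "m + 1 = (real n + 1) / 2" by (simp add: m_def field_simps)
      then show ?thesis
        using gamma_half_ratio[OF assms(2), of "real n + 1"]
        unfolding D_def L_def by (simp only:)
    qed
    have c0: "c > 0" using 1 q by (simp add: c_def)
    have *: "b' * D (m - 1) \<le> b' * D m" "(b - 1) * D (m - 1) \<ge> 0"
      using D_less assms(2,3) D1[of "m - 1"] by simp_all
    \<comment> \<open>This amounts to bounding \<open>c = (1 + b' - b) / q\<close> from below by the
      term subtracted in the claim; the recurrence at \<open>m\<close> brings in
      \<open>D (m + 1)\<close>.\<close>
    have **: "(b - 1) * q \<le> b' * D (m + 1)"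
    proof -
      have "D (m + 1) = b * D m - D (m - 1)" using rec[of m] by linarith
      then have "b' * D (m + 1) - (b - 1) * q
          = (b' * D m - b' * D (m - 1)) + (b - 1) * D (m - 1)"
        by (simp only: q_def) (simp add: algebra_simps)
      with * show ?thesis by linarith
    qed
    have "(b - 1) / (b' * D (m + 1)) \<le> 1 / q"
    proof -
      have "b' * D (m + 1) > 0" using assms(3) D1[of "m + 1"] by (intro mult_pos_pos) auto
      with ** q show ?thesis by (simp add: pos_divide_le_eq pos_le_divide_eq)
    qed
    then have le: "(1 + b' - b) * ((b - 1) / (b' * D (m + 1))) \<le> (1 + b' - b) * (1 / q)"
      using 1 by (intro mult_left_mono) auto
    have c_ge: "2 * (1 + b' - b) * (b - 1) / b' * (1 / (2 * D (m + 1))) \<le> c"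
    proof -
      have "2 * s * t / v * (1 / (2 * w)) = s * (t / (v * w))" for s t v w :: real
        by simp
      with le show ?thesis by (simp only: c_def) simp
    qed
    have "u i \<le> 1 / (b - 2) *
         (1 - 2 * (1 + b' - b) * (b - 1) / b' * (1 / (2 * D (m + 1))))" for i
    proof -
      \<comment> \<open>The value \<open>1\<close> of \<open>D\<close> at the centre is its minimum,
        also when no index lies there.\<close>
      have "c \<le> c * D (m - real i)" using c0 D1 by simp
      with c_ge show ?thesis
        using assms(2) unfolding u_def by (simp add: divide_right_mono)
    qed
    then show ?thesis using 1 norm_le by (simp add: ratio)
  next
    case 2
    \<comment> \<open>Here \<open>c = 0\<close>, so \<open>u\<close> is constant.\<close>
    then show ?thesis using norm_le[of "1 / (b - 2)"] by (simp add: u_def c_def)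
  next
    case 3
    have "b' * b > 2" using mult_right_mono[OF assms(3), of b] assms(2) by linarith
    have t: "b * D (m - 1) \<le> 2 * D m"
    proof -
      \<comment> \<open>From \<open>m \<ge> 1\<close> follows
        \<open>\<bar>m - 2\<bar> \<le> m\<close>, even where \<open>m - 2\<close> is
        negative.\<close>
      have "D (m - 2) \<le> D m" using m by (intro mono) (simp add: abs_le_iff)
      then show ?thesis using rec[of "m - 1"] by simp
    qed
    have "u i \<le> (b + 1) / (b' * b - 2)" if "i < n" for i
    proof -
      have "c \<le> 0" using 3 q by (simp add: c_def divide_nonpos_pos)
      moreover have "\<bar>m - real i\<bar> \<le> \<bar>m\<bar>" using that by (auto simp: m_def abs_le_iff field_simps)
      ultimately have "c * D m \<le> c * D (m - real i)" by (intro mult_left_mono_neg mono)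
      then have "u i \<le> (1 - c * D m) / (b - 2)"
        using assms(2) by (simp add: u_def divide_right_mono)
      also have "1 - c * D m = ((b - 1) * D m - D (m - 1)) / q"
      proof -
        have "1 - c * D m = (q - (1 + b' - b) * D m) / q"
          using q by (simp add: c_def diff_divide_distrib[of q])
        also have "q - (1 + b' - b) * D m = (b - 1) * D m - D (m - 1)"
          by (simp add: q_def algebra_simps)
        finally show ?thesis .
      qed
      also have "\<dots> / (b - 2) \<le> (b + 1) / (b' * b - 2)"
      proof -
        \<comment> \<open>After clearing denominators, the difference of the two sides factors into
          this product.\<close>
        have "0 \<le> (b - 1 - b') * (2 * D m - b * D (m - 1))"
          using 3 t by simp
        also have "\<dots> = (b + 1) * (b - 2) * q - ((b - 1) * D m - D (m - 1)) * (b' * b - 2)"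
          by (simp add: q_def algebra_simps)
        finally have "((b - 1) * D m - D (m - 1)) * (b' * b - 2) \<le> (b + 1) * ((b - 2) * q)"
          by (simp only: mult.assoc)
        moreover have "(b - 2) * q > 0" using q assms(2) by simp
        ultimately have "((b - 1) * D m - D (m - 1)) / ((b - 2) * q) \<le> (b + 1) / (b' * b - 2)"
          using \<open>b' * b > 2\<close> by (simp only: pos_divide_le_eq times_divide_eq_left)
            (simp add: pos_le_divide_eq)
        then show ?thesis by (simp add: mult.commute)
      qed
      finally show ?thesis .
    qed
    then show ?thesis using 3 norm_le by simp
  qed
qed

end
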